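(* Let $n\ge2$ be an integer, let $K\in\mathbb{R}_{\ge1}$, and let $\mathcal{S}$ be the set of real $n\times n$ matrices $A$ such that $\|A\|_{\infty\to1}\le K$. Then, for matrices $A,B\in\mathcal{S}$, regarded as $P$-operators on $\{1,\dots,n\}$ with the uniform probability measure, $d_M(A,B)=0$ if and only if $d_S(A,B)=0$.
   Context: Let $\Omega=\{1,\dots,n\}$ carry the uniform probability measure $\mathbb{P}$, so $L^\infty(\Omega)=L^1(\Omega)=\mathbb{R}^n$ with $\|\mathbf{v}\|_\infty=\max_i|v_i|$, $\|\mathbf{v}\|_1=\sum_i\frac1n|v_i|$. A $P$-operator is a linear operator $A:L^\infty(\Omega)\to L^1(\Omega)$ with finite norm $\|A\|_{\infty\to1}=\sup_{\mathbf{v}\ne0}\|A\mathbf{v}\|_1/\|\mathbf{v}\|_\infty$; every real $n\times n$ matrix is one. For $k\ge1$, the $k$-profile $\mathcal{S}_k(A)$ is the set of probability measures on $\mathbb{R}^{2k}$ that are laws (pushforwards of $\mathbb{P}$) of the random vectors $(Z_1,AZ_1,Z_2,AZ_2,\dots,Z_k,AZ_k)$, where $Z_1,\dots,Z_k$ range over all elements of $L^\infty(\Omega)$ with values in $[-1,1]$. For probability measures on $\mathbb{R}^p$, the Lévy–Prokhorov metric is $d_{\mathrm{LP}}(\eta_1,\eta_2)=\inf\{\varepsilon>0:\eta_1(U)\le\eta_2(U^\varepsilon)+\varepsilon$ and $\eta_2(U)\le\eta_1(U^\varepsilon)+\varepsilon$ for all Borel $U\}$, where $U^\varepsilon$ is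 the set of points at distance smaller than $\varepsilon$ from $U$. For sets $X,Y$ of probability measures on $\mathbb{R}^p$, $d_H(X,Y)=\max\{\sup_{x\in X}\inf_{y\in Y}d_{\mathrm{LP}}(x,y),\ \sup_{y\in Y}\inf_{x\in X}d_{\mathrm{LP}}(x,y)\}$. The action convergence distance is $d_M(A,B)=\sum_{k=1}^\infty 2^{-k}d_H(\mathcal{S}_k(A),\mathcal{S}_k(B))$ and the $1$-profile distance is $d_S(A,B)=d_H(\mathcal{S}_1(A),\mathcal{S}_1(B))$. *)

theory Defs
  imports "HOL-Probability.Probability"
begin

text \<open>
  The index type \<open>'n\<close> plays the role of the sample space \<open>{1, ..., n}\<close> with
  \<open>n = CARD('n)\<close>; it carries the measure \<open>uniform_count_measure UNIV\<close>, and a function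
  on it is a vector in \<open>real ^ 'n\<close>.
\<close>

definition linf_norm :: "real ^ 'n \<Rightarrow> real" where
  "linf_norm v = (MAX i. \<bar>v $ i\<bar>)"

definition l1_norm :: "real ^ 'n \<Rightarrow> real" where
  "l1_norm v = (\<Sum>i\<in>UNIV. 1 / real CARD('n) * \<bar>v $ i\<bar>)"

definition inf_one_norm :: "real ^ 'n ^ 'n \<Rightarrow> real" where
  "inf_one_norm A = (SUP v\<in>{v. v \<noteq> 0}. l1_norm (A *v v) / linf_norm v)"

text \<open>
  The dimension \<open>p\<close> varies inside the definition of \<open>d_action\<close>, so \<open>R^p\<close> is represented by
  the functions \<open>nat \<Rightarrow> real\<close> supported (extensionally) on \<open>{..<p}\<close>. The product
  \<open>\<sigma>\<close>-algebra on it is the Borel \<open>\<sigma>\<close>-algebra, and distances are Euclidean.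
\<close>

definition borel_Rp :: "nat \<Rightarrow> (nat \<Rightarrow> real) measure" where
  "borel_Rp p = PiM {..<p} (\<lambda>_. borel)"

definition dist_Rp :: "nat \<Rightarrow> (nat \<Rightarrow> real) \<Rightarrow> (nat \<Rightarrow> real) \<Rightarrow> real" where
  "dist_Rp p x y = L2_set (\<lambda>i. x i - y i) {..<p}"

text \<open>
  Being at distance less than \<open>\<epsilon>\<close> from \<open>U\<close> means being at distance less than \<open>\<epsilon>\<close> from some
  point of \<open>U\<close>; in particular the neighbourhood of the empty set is empty.
\<close>

definition nbhd_Rp :: "nat \<Rightarrow> real \<Rightarrow> (nat \<Rightarrow> real) set \<Rightarrow> (nat \<Rightarrow> real) set" where
  "nbhd_Rp p \<epsilon> U = {x \<in> space (borel_Rp p). \<exists>u\<in>U. dist_Rp p x u < \<epsilon>}"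

definition d_LP :: "nat \<Rightarrow> (nat \<Rightarrow> real) measure \<Rightarrow> (nat \<Rightarrow> real) measure \<Rightarrow> real" where
  "d_LP p \<eta>1 \<eta>2 = Inf {\<epsilon>. 0 < \<epsilon> \<and>
     (\<forall>U\<in>sets (borel_Rp p).
        measure \<eta>1 U \<le> measure \<eta>2 (nbhd_Rp p \<epsilon> U) + \<epsilon> \<and>
        measure \<eta>2 U \<le> measure \<eta>1 (nbhd_Rp p \<epsilon> U) + \<epsilon>)}"

definition d_H :: "nat \<Rightarrow> (nat \<Rightarrow> real) measure set \<Rightarrow> (nat \<Rightarrow> real) measure set \<Rightarrow> real" where
  "d_H p X Y = max (SUP x\<in>X. INF y\<in>Y. d_LP p x y) (SUP y\<in>Y. INF x\<in>X. d_LP p x y)"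

text \<open>
  The random vector \<open>(Z\<^sub>1, A Z\<^sub>1, ..., Z\<^sub>k, A Z\<^sub>k)\<close>, with coordinates and test vectors numbered
  from 0: coordinate \<open>2 j\<close> is \<open>Z j\<close> and coordinate \<open>2 j + 1\<close> is \<open>A (Z j)\<close>.
\<close>

definition profile_vector ::
    "nat \<Rightarrow> real ^ 'n ^ 'n \<Rightarrow> (nat \<Rightarrow> real ^ 'n) \<Rightarrow> 'n \<Rightarrow> nat \<Rightarrow> real" where
  "profile_vector k A Z \<omega> =
     (\<lambda>m\<in>{..<2 * k}. if even m then Z (m div 2) $ \<omega> else (A *v Z (m div 2)) $ \<omega>)"

definition profile :: "nat \<Rightarrow> real ^ 'n ^ 'n \<Rightarrow> (nat \<Rightarrow> real) measure set" where
  "profile k A =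
     {distr (uniform_count_measure UNIV) (borel_Rp (2 * k)) (profile_vector k A Z) | Z.
        \<forall>j<k. \<forall>\<omega>. Z j $ \<omega> \<in> {-1..1}}"

text \<open>The summand with index \<open>k\<close> is the one for \<open>(k + 1)\<close>-profiles.\<close>

definition d_action :: "real ^ 'n ^ 'n \<Rightarrow> real ^ 'n ^ 'n \<Rightarrow> real" where
  "d_action A B =
     (\<Sum>k. (1 / 2) ^ Suc k * d_H (2 * Suc k) (profile (Suc k) A) (profile (Suc k) B))"

definition d_profile :: "real ^ 'n ^ 'n \<Rightarrow> real ^ 'n ^ 'n \<Rightarrow> real" where
  "d_profile A B = d_H 2 (profile 1 A) (profile 1 B)"

text \<open>
  The suprema, infima and series above are taken in the reals. The following facts show that
  all of them are taken over nonempty, suitably bounded sets, respectively converge, and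
  that the sets whose measures enter \<open>d_LP\<close> are measurable.
\<close>

lemma inf_one_norm_bdd:
  fixes A :: "real ^ 'n ^ 'n"
  shows "bdd_above ((\<lambda>v. l1_norm (A *v v) / linf_norm v) ` {v. v \<noteq> 0})"
proof (rule bdd_aboveI2)
  fix v :: "real ^ 'n"
  assume "v \<in> {v. v \<noteq> 0}"
  then obtain i where i: "v $ i \<noteq> 0" by (auto simp: vec_eq_iff)
  have le: "\<bar>v $ j\<bar> \<le> linf_norm v" for j unfolding linf_norm_def by (rule Max_ge) auto
  have pos: "0 < linf_norm v" using le[of i] i by linarith
  have "\<bar>(A *v v) $ a\<bar> \<le> (\<Sum>j\<in>UNIV. \<bar>A $ a $ j\<bar>) * linf_norm v" for a
  proof -
    have "\<bar>(A *v v) $ a\<bar> \<le> (\<Sum>j\<in>UNIV. \<bar>A $ a $ j * v $ j\<bar>)"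
      by (simp add: matrix_vector_mult_def sum_abs)
    also have "\<dots> \<le> (\<Sum>j\<in>UNIV. \<bar>A $ a $ j\<bar> * linf_norm v)"
      by (intro sum_mono) (simp add: abs_mult mult_left_mono le)
    finally show ?thesis by (simp add: sum_distrib_right)
  qed
  then have "l1_norm (A *v v) \<le>
      (\<Sum>a\<in>UNIV. 1 / real CARD('n) * ((\<Sum>j\<in>UNIV. \<bar>A $ a $ j\<bar>) * linf_norm v))"
    unfolding l1_norm_def by (intro sum_mono mult_left_mono) auto
  also have "\<dots> = (\<Sum>a\<in>UNIV. 1 / real CARD('n) * (\<Sum>j\<in>UNIV. \<bar>A $ a $ j\<bar>)) * linf_norm v"
    by (simp add: sum_distrib_right mult.assoc)
  finally show "l1_norm (A *v v) / linf_norm v \<le>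
      (\<Sum>a\<in>UNIV. 1 / real CARD('n) * (\<Sum>j\<in>UNIV. \<bar>A $ a $ j\<bar>))"
    using pos by (simp add: divide_le_eq)
qed

lemma prob_space_profile:
  assumes "\<eta> \<in> profile k (A :: real ^ 'n ^ 'n)"
  shows "prob_space \<eta>" and "sets \<eta> = sets (borel_Rp (2 * k))"
proof -
  obtain Z where Z: "\<eta> = distr (uniform_count_measure UNIV) (borel_Rp (2 * k)) (profile_vector k A Z)"
    using assms by (auto simp: profile_def)
  have "profile_vector k A Z \<in> measurable (uniform_count_measure UNIV) (borel_Rp (2 * k))"
    by (auto simp: measurable_def space_uniform_count_measure sets_uniform_count_measure
        borel_Rp_def space_PiM profile_vector_def)
  moreover have "prob_space (uniform_count_measure (UNIV :: 'n set))"
    by (rule prob_space_uniform_count_measure) auto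
  ultimately show "prob_space \<eta>" unfolding Z by (intro prob_space.prob_space_distr)
  show "sets \<eta> = sets (borel_Rp (2 * k))" by (simp add: Z)
qed

lemma profile_nonempty: "profile k A \<noteq> {}"
  unfolding profile_def by (auto intro!: exI[of _ "\<lambda>_. 0"])

lemma nbhd_Rp_sets: "nbhd_Rp p \<epsilon> U \<in> sets (borel_Rp p)" if "U \<subseteq> space (borel_Rp p)"
proof -
  let ?R = "\<lambda>x :: nat \<Rightarrow> real. restrict x {..<p}"
  let ?N = "{x :: nat \<Rightarrow> real. \<exists>u\<in>U. dist_Rp p x u < \<epsilon>}"
  have "open ?N"
  proof -
    have "continuous_on UNIV (\<lambda>x :: nat \<Rightarrow> real. dist_Rp p x u)" for u
      unfolding dist_Rp_def L2_set_def
      by (intro continuous_intros) auto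
    then have "open {x :: nat \<Rightarrow> real. dist_Rp p x u < \<epsilon>}" for u
      by (intro open_Collect_less continuous_intros) auto
    moreover have "?N = (\<Union>u\<in>U. {x. dist_Rp p x u < \<epsilon>})" by auto
    ultimately show ?thesis by auto
  qed
  then have N: "?N \<in> sets (PiM UNIV (\<lambda>_ :: nat. borel :: real measure))"
    by (subst sets_PiM_equal_borel) auto
  define E where "E = (\<lambda>(x :: nat \<Rightarrow> real) i. if i < p then x i else 0)"
  have E: "E \<in> measurable (borel_Rp p) (PiM UNIV (\<lambda>_ :: nat. borel :: real measure))"
    unfolding E_def borel_Rp_def
  proof (rule measurable_PiM_single')
    fix i :: nat
    show "(\<lambda>x. if i < p then x i else 0) \<in> borel_measurable (PiM {..<p} (\<lambda>_. borel))"
      by (cases "i < p") auto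
  qed auto
  have "dist_Rp p (E x) u = dist_Rp p x u" for x u
    unfolding dist_Rp_def L2_set_def E_def by (intro arg_cong[where f = sqrt] sum.cong) auto
  then have "nbhd_Rp p \<epsilon> U = E -` ?N \<inter> space (borel_Rp p)"
    by (auto simp: nbhd_Rp_def)
  then show ?thesis using measurable_sets[OF E N] by simp
qed

lemma one_mem_LP_set:
  assumes "prob_space \<eta>1" "prob_space \<eta>2"
  shows "(1 :: real) \<in> {\<epsilon>. 0 < \<epsilon> \<and>
     (\<forall>U\<in>sets (borel_Rp p).
        measure \<eta>1 U \<le> measure \<eta>2 (nbhd_Rp p \<epsilon> U) + \<epsilon> \<and>
        measure \<eta>2 U \<le> measure \<eta>1 (nbhd_Rp p \<epsilon> U) + \<epsilon>)}"
  using assms by (auto intro!: add_increasing simp: prob_space.prob_le_1)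

lemma d_LP_bounds:
  assumes "prob_space \<eta>1" "prob_space \<eta>2"
  shows "0 \<le> d_LP p \<eta>1 \<eta>2" and "d_LP p \<eta>1 \<eta>2 \<le> 1"
proof -
  show "0 \<le> d_LP p \<eta>1 \<eta>2"
    unfolding d_LP_def
    by (rule cInf_greatest) (use one_mem_LP_set[OF assms] in \<open>blast, auto\<close>)
  show "d_LP p \<eta>1 \<eta>2 \<le> 1"
    unfolding d_LP_def
    by (rule cInf_lower[OF one_mem_LP_set[OF assms]]) (rule bdd_belowI[of _ 0], auto)
qed

lemma SUP_INF_bounds:
  fixes d :: "'a \<Rightarrow> 'b \<Rightarrow> real"
  assumes "X \<noteq> {}" "Y \<noteq> {}" "\<And>x y. x \<in> X \<Longrightarrow> y \<in> Y \<Longrightarrow> 0 \<le> d x y \<and> d x y \<le> 1"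
  shows "bdd_above ((\<lambda>x. INF y\<in>Y. d x y) ` X)"
    and "0 \<le> (SUP x\<in>X. INF y\<in>Y. d x y)" and "(SUP x\<in>X. INF y\<in>Y. d x y) \<le> 1"
proof -
  have ge: "0 \<le> (INF y\<in>Y. d x y)" if "x \<in> X" for x
    using assms that by (intro cINF_greatest) auto
  have le: "(INF y\<in>Y. d x y) \<le> 1" if "x \<in> X" for x
  proof -
    obtain y where y: "y \<in> Y" using assms by auto
    have "bdd_below (d x ` Y)" using assms(3) that by (intro bdd_belowI2[of _ 0]) auto
    then have "(INF y\<in>Y. d x y) \<le> d x y" using y by (rule cINF_lower)
    also have "\<dots> \<le> 1" using assms(3) that y by auto
    finally show ?thesis .
  qed
  show bdd: "bdd_above ((\<lambda>x. INF y\<in>Y. d x y) ` X)" using le by (rule bdd_aboveI2)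
  obtain x where x: "x \<in> X" using assms by auto
  show "0 \<le> (SUP x\<in>X. INF y\<in>Y. d x y)"
    using ge[OF x] cSUP_upper[OF x bdd] by linarith
  show "(SUP x\<in>X. INF y\<in>Y. d x y) \<le> 1" using assms le by (intro cSUP_least) auto
qed

lemma d_H_profile_bounds:
  fixes A B :: "real ^ 'n ^ 'n"
  shows "0 \<le> d_H (2 * k) (profile k A) (profile k B)"
    and "d_H (2 * k) (profile k A) (profile k B) \<le> 1"
proof -
  have *: "0 \<le> d_LP (2 * k) x y \<and> d_LP (2 * k) x y \<le> 1"
    if "x \<in> profile k A" "y \<in> profile k B" for x y
    using that by (simp add: d_LP_bounds prob_space_profile)
  note 1 = SUP_INF_bounds[OF profile_nonempty[of k A] profile_nonempty[of k B],
      of "d_LP (2 * k)", OF *]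
  note 2 = SUP_INF_bounds[OF profile_nonempty[of k B] profile_nonempty[of k A],
      of "\<lambda>y x. d_LP (2 * k) x y", OF *]
  show "0 \<le> d_H (2 * k) (profile k A) (profile k B)"
    unfolding d_H_def using 1(2) by (simp add: le_max_iff_disj)
  show "d_H (2 * k) (profile k A) (profile k B) \<le> 1"
    unfolding d_H_def using 1(3) 2(3) by simp
qed

lemma d_action_summable:
  fixes A B :: "real ^ 'n ^ 'n"
  shows "summable (\<lambda>k. (1 / 2) ^ Suc k * d_H (2 * Suc k) (profile (Suc k) A) (profile (Suc k) B))"
proof (rule summable_comparison_test'[of "\<lambda>k. (1 / 2 :: real) ^ Suc k" 0])
  show "summable (\<lambda>k. (1 / 2 :: real) ^ Suc k)"
    by (subst summable_Suc_iff) (simp add: summable_geometric)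
  show "norm ((1 / 2) ^ Suc k * d_H (2 * Suc k) (profile (Suc k) A) (profile (Suc k) B))
      \<le> (1 / 2) ^ Suc k" for k
    using d_H_profile_bounds[of "Suc k" A B]
    by (simp add: abs_mult mult_left_le)
qed

end

theory Submission
  imports Defs
begin

text \<open>
  If the \<open>1\<close>-profiles are at distance zero, then for every test vector \<open>Z\<close> with distinct
  coordinates the atoms of the law of \<open>(Z, A Z)\<close> are matched, up to any \<open>\<epsilon>\<close>, with those of
  some \<open>(W, B W)\<close>; once \<open>\<epsilon>\<close> is smaller than half the gaps of \<open>Z\<close> this matching is a permutation
  \<open>\<sigma>\<close>. As there are finitely many permutations, some \<open>\<sigma>\<close> satisfies exactly
  \<open>B (P\<^sub>\<sigma> Z) = P\<^sub>\<sigma> (A Z)\<close>. Applying this to the points \<open>Z = (t ^ e i)\<^sub>i\<close>, \<open>0 < t < 1\<close>, of a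
  moment curve, one \<open>\<sigma>\<close> serves infinitely many \<open>t\<close>, so the polynomial identities in \<open>t\<close> force
  \<open>B P\<^sub>\<sigma> = P\<^sub>\<sigma> A\<close>. Then all \<open>k\<close>-profiles of \<open>A\<close> and \<open>B\<close> coincide.
\<close>

section \<open>Laws of profile vectors as counting measures\<close>

lemma space_borel_Rp: "space (borel_Rp p) = extensional {..<p}"
  by (simp add: borel_Rp_def space_PiM PiE_def)

lemma profile_vector_extensional: "profile_vector k A Z \<omega> \<in> extensional {..<2 * k}"
  by (simp add: profile_vector_def)

lemma measurable_profile_vector:
  "profile_vector k A Z \<in> measurable (uniform_count_measure UNIV) (borel_Rp (2 * k))"
  by (auto simp: measurable_def space_uniform_count_measure sets_uniform_count_measure
      space_borel_Rp profile_vector_extensional)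

lemma measure_profile_law:
  fixes A :: "real ^ 'n ^ 'n"
  assumes "U \<in> sets (borel_Rp (2 * k))"
  shows "measure (distr (uniform_count_measure UNIV) (borel_Rp (2 * k)) (profile_vector k A Z)) U
    = card {\<omega>. profile_vector k A Z \<omega> \<in> U} / CARD('n)"
  using assms by (subst measure_distr[OF measurable_profile_vector])
    (auto simp: measure_uniform_count_measure space_uniform_count_measure vimage_def)

lemma singleton_sets_borel_Rp:
  assumes "x \<in> extensional {..<p}"
  shows "{x} \<in> sets (borel_Rp p)"
proof -
  have "{x} = PiE {..<p} (\<lambda>i. {x i})"
    using assms by (simp add: PiE_singleton)
  also have "\<dots> \<in> sets (borel_Rp p)"
    unfolding borel_Rp_def by (rule sets_PiM_I_finite) auto
  finally show ?thesis .
qed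

lemma abs_le_dist_Rp: "i < p \<Longrightarrow> \<bar>x i - y i\<bar> \<le> dist_Rp p x y"
  unfolding dist_Rp_def using member_le_L2_set[of "{..<p}" i "\<lambda>i. \<bar>x i - y i\<bar>"]
  by (simp add: L2_set_def)

section \<open>Vanishing of the Levy-Prokhorov and Hausdorff distances\<close>

lemma d_LP_refl:
  assumes "prob_space \<eta>" "sets \<eta> = sets (borel_Rp p)"
  shows "d_LP p \<eta> \<eta> = 0"
proof (rule antisym)
  interpret prob_space \<eta> by fact
  have "d_LP p \<eta> \<eta> \<le> \<epsilon>" if "0 < \<epsilon>" for \<epsilon>
    unfolding d_LP_def
  proof (rule cInf_lower)
    have "measure \<eta> U \<le> measure \<eta> (nbhd_Rp p \<epsilon> U)" if U: "U \<in> sets (borel_Rp p)" for U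
    proof (rule finite_measure_mono)
      have sub: "U \<subseteq> space (borel_Rp p)" using U by (rule sets.sets_into_space)
      show "U \<subseteq> nbhd_Rp p \<epsilon> U"
        using sub \<open>0 < \<epsilon>\<close> by (auto simp: nbhd_Rp_def dist_Rp_def L2_set_def intro!: bexI)
      show "nbhd_Rp p \<epsilon> U \<in> sets \<eta>" using nbhd_Rp_sets[OF sub] assms by simp
    qed
    then show "\<epsilon> \<in> {\<epsilon>. 0 < \<epsilon> \<and> (\<forall>U\<in>sets (borel_Rp p).
        measure \<eta> U \<le> measure \<eta> (nbhd_Rp p \<epsilon> U) + \<epsilon> \<and>
        measure \<eta> U \<le> measure \<eta> (nbhd_Rp p \<epsilon> U) + \<epsilon>)}"
      using that by (auto intro: add_increasing2)
  qed (rule bdd_belowI[of _ 0], auto)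
  then show "d_LP p \<eta> \<eta> \<le> 0" by (rule field_le_epsilon[of _ 0, simplified])
  show "0 \<le> d_LP p \<eta> \<eta>" using assms(1) by (intro d_LP_bounds)
qed

lemma d_H_profile_self: "d_H (2 * k) (profile k A) (profile k A) = 0"
proof -
  have ge: "0 \<le> d_LP (2 * k) x y" if "x \<in> profile k A" "y \<in> profile k A" for x y
    using that by (simp add: d_LP_bounds prob_space_profile)
  have "(INF y\<in>profile k A. d_LP (2 * k) x y) = 0 \<and> (INF y\<in>profile k A. d_LP (2 * k) y x) = 0"
    if x: "x \<in> profile k A" for x
  proof -
    have refl: "d_LP (2 * k) x x = 0" using prob_space_profile[OF x] by (rule d_LP_refl)
    have "bdd_below (d_LP (2 * k) x ` profile k A)"
      "bdd_below ((\<lambda>y. d_LP (2 * k) y x) ` profile k A)"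
      using ge x by (auto intro!: bdd_belowI2[of _ 0])
    then have "(INF y\<in>profile k A. d_LP (2 * k) x y) \<le> 0"
      "(INF y\<in>profile k A. d_LP (2 * k) y x) \<le> 0"
      using x refl by (auto intro: cINF_lower2)
    moreover have "0 \<le> (INF y\<in>profile k A. d_LP (2 * k) x y)"
      "0 \<le> (INF y\<in>profile k A. d_LP (2 * k) y x)"
      using ge x by (auto intro!: cINF_greatest)
    ultimately show ?thesis by simp
  qed
  then show ?thesis
    unfolding d_H_def using profile_nonempty[of k A] by simp
qed

text \<open>Neither infimum is known to be attained, so distance zero gives only an approximating
  law for each tolerance \<open>\<delta>\<close>. The inequality bounding \<open>x\<close> from
  above is kept: it forces \<open>y\<close> to put mass near every atom of \<open>x\<close>.\<close>

lemma d_H_profile_zeroD: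
  fixes A B :: "real ^ 'n ^ 'n"
  assumes "d_H (2 * k) (profile k A) (profile k B) = 0" and x: "x \<in> profile k A" and "0 < \<delta>"
  obtains y \<epsilon> where "y \<in> profile k B" "0 < \<epsilon>" "\<epsilon> < \<delta>"
    "\<And>U. U \<in> sets (borel_Rp (2 * k)) \<Longrightarrow> measure x U \<le> measure y (nbhd_Rp (2 * k) \<epsilon> U) + \<epsilon>"
proof -
  have *: "0 \<le> d_LP (2 * k) x y \<and> d_LP (2 * k) x y \<le> 1"
    if "x \<in> profile k A" "y \<in> profile k B" for x y
    using that by (simp add: d_LP_bounds prob_space_profile)
  have "(INF y\<in>profile k B. d_LP (2 * k) x y) \<le>
      (SUP x\<in>profile k A. INF y\<in>profile k B. d_LP (2 * k) x y)"
    using x by (rule cSUP_upper)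
      (rule SUP_INF_bounds(1)[OF profile_nonempty[of k A] profile_nonempty[of k B] *])
  also have "\<dots> \<le> 0" using assms(1) by (simp add: d_H_def max_def split: if_splits)
  finally have "(INF y\<in>profile k B. d_LP (2 * k) x y) < \<delta>" using \<open>0 < \<delta>\<close> by simp
  then obtain y where y: "y \<in> profile k B" "d_LP (2 * k) x y < \<delta>"
    using cInf_lessD[of "d_LP (2 * k) x ` profile k B" \<delta>] profile_nonempty[of k B] by auto
  let ?E = "{\<epsilon>. 0 < \<epsilon> \<and> (\<forall>U\<in>sets (borel_Rp (2 * k)).
        measure x U \<le> measure y (nbhd_Rp (2 * k) \<epsilon> U) + \<epsilon> \<and>
        measure y U \<le> measure x (nbhd_Rp (2 * k) \<epsilon> U) + \<epsilon>)}"
  have "1 \<in> ?E"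
    by (rule one_mem_LP_set) (use x y prob_space_profile in blast)+
  then have "?E \<noteq> {}" by blast
  then obtain \<epsilon> where "\<epsilon> \<in> ?E" "\<epsilon> < \<delta>"
    using cInf_lessD[of ?E \<delta>] y(2) unfolding d_LP_def by blast
  then show ?thesis using that y(1) by blast
qed

section \<open>From distance zero of 1-profiles to permutation similarity\<close>

text \<open>Each atom of the law of \<open>(Z, A Z)\<close> has mass at least
  \<open>1 / CARD('n)\<close>, so for smaller \<open>\<epsilon>\<close> its neighbourhood must
  contain a value of \<open>(W, B W)\<close>. Choosing one index for each atom gives
  \<open>\<sigma>\<close>; it is injective because no number lies too close to two distinct
  coordinates of \<open>Z\<close>.\<close>

lemma profile_approx_permutation:
  fixes A B :: "real ^ 'n ^ 'n" and Z :: "real ^ 'n"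
  assumes H: "d_H 2 (profile 1 A) (profile 1 B) = 0"
    and Z: "\<And>i. Z $ i \<in> {-1..1}" and inj: "inj (($) Z)" and "0 < \<delta>"
  obtains \<sigma> W where "bij \<sigma>" "\<And>i. \<bar>W $ \<sigma> i - Z $ i\<bar> < \<delta>" "\<And>i. \<bar>(B *v W) $ \<sigma> i - (A *v Z) $ i\<bar> < \<delta>"
proof -
  define G where "G = (\<lambda>(i, j). \<bar>Z $ i - Z $ j\<bar> / 2) ` {(i, j). i \<noteq> j}"
  \<comment> \<open>The three bounds give the required accuracy, a tolerance no larger than the mass
    of an atom, and, through the half gaps in \<open>G\<close>, injectivity of
    \<open>\<sigma>\<close>.\<close>
  define d where "d = Min (insert \<delta> (insert (1 / CARD('n)) G))"
  have fin: "finite (insert \<delta> (insert (1 / CARD('n)) G))" by (simp add: G_def)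
  have "0 < g" if "g \<in> G" for g
    using that inj by (auto simp: G_def dest: injD)
  then have "0 < d" unfolding d_def using fin \<open>0 < \<delta>\<close> by (subst Min_gr_iff) auto
  have "d \<le> g" if "g \<in> insert \<delta> (insert (1 / CARD('n)) G)" for g
    unfolding d_def using fin that by (rule Min_le)
  then have d1: "d \<le> \<delta>" "d \<le> 1 / CARD('n)" and dG: "\<And>g. g \<in> G \<Longrightarrow> d \<le> g" by simp_all
  define x where "x = profile_vector 1 A (\<lambda>_. Z)"
  have "distr (uniform_count_measure UNIV) (borel_Rp (2 * 1)) x \<in> profile 1 A"
    using Z unfolding profile_def x_def by blast
  with H obtain y \<epsilon> where y: "y \<in> profile 1 B" and \<epsilon>: "\<epsilon> < d" and
    le: "\<And>U. U \<in> sets (borel_Rp 2) \<Longrightarrow>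
      measure (distr (uniform_count_measure UNIV) (borel_Rp 2) x) U \<le> measure y (nbhd_Rp 2 \<epsilon> U) + \<epsilon>"
    using d_H_profile_zeroD[of 1 A B _ d] \<open>0 < d\<close> by (metis mult.right_neutral)
  obtain V where V: "y = distr (uniform_count_measure UNIV) (borel_Rp 2) (profile_vector 1 B V)"
    using y by (auto simp: profile_def)
  have "\<exists>j. profile_vector 1 B V j \<in> nbhd_Rp 2 \<epsilon> {x i}" for i
  proof (rule ccontr)
    assume none: "\<nexists>j. profile_vector 1 B V j \<in> nbhd_Rp 2 \<epsilon> {x i}"
    have ext: "x i \<in> extensional {..<2}"
      using profile_vector_extensional[of 1 A] by (simp add: x_def)
    then have S: "{x i} \<in> sets (borel_Rp 2)" by (rule singleton_sets_borel_Rp)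
    have "nbhd_Rp 2 \<epsilon> {x i} \<in> sets (borel_Rp 2)"
      by (rule nbhd_Rp_sets) (simp add: space_borel_Rp ext)
    then have "measure y (nbhd_Rp 2 \<epsilon> {x i}) = 0"
      using measure_profile_law[of "nbhd_Rp 2 \<epsilon> {x i}" 1 B V] none by (simp add: V)
    moreover have "1 \<le> card {j. x j \<in> {x i}}"
      by (metis (mono_tags, lifting) One_nat_def Suc_leI card_gt_0_iff empty_iff finite
          mem_Collect_eq singletonI)
    then have "1 / CARD('n) \<le> measure (distr (uniform_count_measure UNIV) (borel_Rp 2) x) {x i}"
      using measure_profile_law[of "{x i}" 1 A "\<lambda>_. Z"] S
      by (simp add: x_def divide_right_mono)
    ultimately show False using le[OF S] \<epsilon> d1 by linarith
  qed
  then obtain \<sigma> where \<sigma>: "\<And>i. profile_vector 1 B V (\<sigma> i) \<in> nbhd_Rp 2 \<epsilon> {x i}" by metis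
  have close: "\<bar>profile_vector 1 B V (\<sigma> i) m - x i m\<bar> < d" if "m < 2" for i m
    using \<sigma>[of i] abs_le_dist_Rp[OF that, of "profile_vector 1 B V (\<sigma> i)" "x i"] \<epsilon>
    by (auto simp: nbhd_Rp_def)
  have c0: "\<bar>V 0 $ \<sigma> i - Z $ i\<bar> < d" for i
    using close[of 0 i] by (simp add: x_def profile_vector_def)
  have c1: "\<bar>(B *v V 0) $ \<sigma> i - (A *v Z) $ i\<bar> < d" for i
    using close[of 1 i] by (simp add: x_def profile_vector_def)
  have "inj \<sigma>"
  proof (rule injI, rule ccontr)
    fix i j assume "\<sigma> i = \<sigma> j" "i \<noteq> j"
    then have "d \<le> \<bar>Z $ i - Z $ j\<bar> / 2" by (intro dG) (auto simp: G_def)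
    then show False using c0[of i] c0[of j] \<open>\<sigma> i = \<sigma> j\<close> by simp
  qed
  then have "bij \<sigma>" by (simp add: bij_def finite_UNIV_inj_surj)
  then show ?thesis using that[of \<sigma> "V 0"] c0 c1 d1(1) by (meson less_le_trans)
qed

text \<open>The defect \<open>D \<sigma> i\<close> involves \<open>Z\<close> but not the
  approximating \<open>W\<close>, and it takes only finitely many values. An approximation finer
  than the least nonzero one therefore makes it vanish.\<close>

lemma profile_exact_permutation:
  fixes A B :: "real ^ 'n ^ 'n" and Z :: "real ^ 'n"
  assumes H: "d_H 2 (profile 1 A) (profile 1 B) = 0"
    and Z: "\<And>i. Z $ i \<in> {-1..1}" and inj: "inj (($) Z)"
  obtains \<sigma> where "bij \<sigma>" "\<And>i. (\<Sum>j\<in>UNIV. (B $ \<sigma> i $ \<sigma> j - A $ i $ j) * Z $ j) = 0"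
proof -
  define D where "D = (\<lambda>(\<sigma> :: 'n \<Rightarrow> 'n) i. \<Sum>j\<in>UNIV. (B $ \<sigma> i $ \<sigma> j - A $ i $ j) * Z $ j)"
  define S where "S = (\<lambda>(\<sigma>, i). \<bar>D \<sigma> i\<bar>) ` {(\<sigma>, i). D \<sigma> i \<noteq> 0}"
  \<comment> \<open>The element 1 keeps the minimum meaningful and positive when every defect is
    zero.\<close>
  define d where "d = Min (insert 1 S)"
  have fin: "finite S" by (simp add: S_def)
  have "0 < d" unfolding d_def using fin by (subst Min_gr_iff) (auto simp: S_def)
  have dS: "d \<le> \<bar>D \<sigma> i\<bar>" if "D \<sigma> i \<noteq> 0" for \<sigma> i
    unfolding d_def using fin that by (intro Min_le) (auto simp: S_def)
  \<comment> \<open>At accuracy \<open>d / C\<close>, the error in \<open>B *v W\<close> costs less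
    than \<open>d / C\<close>, and replacing \<open>W\<close> by the permuted \<open>Z\<close> costs
    at most \<open>(C - 1) * (d / C)\<close>; together less than \<open>d\<close>.\<close>
  define C where "C = 1 + (\<Sum>i\<in>UNIV. \<Sum>j\<in>UNIV. \<bar>B $ i $ j\<bar>)"
  have row: "(\<Sum>j\<in>UNIV. \<bar>B $ i $ j\<bar>) \<le> C - 1" for i
    unfolding C_def using member_le_sum[of i UNIV "\<lambda>i. \<Sum>j\<in>UNIV. \<bar>B $ i $ j\<bar>"]
    by (simp add: sum_nonneg)
  have "1 \<le> C" by (simp add: C_def sum_nonneg)
  have "0 < d / C" using \<open>0 < d\<close> \<open>1 \<le> C\<close> by simp
  obtain \<sigma> W where \<sigma>: "bij \<sigma>" and W: "\<And>i. \<bar>W $ \<sigma> i - Z $ i\<bar> < d / C"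
    and BW: "\<And>i. \<bar>(B *v W) $ \<sigma> i - (A *v Z) $ i\<bar> < d / C"
    using profile_approx_permutation[OF H Z inj \<open>0 < d / C\<close>] by blast
  have reindex: "(\<Sum>j\<in>UNIV. f (\<sigma> j)) = (\<Sum>j\<in>UNIV. f j)" for f :: "'n \<Rightarrow> real"
    using sum.reindex_bij_betw[OF \<sigma>] .
  have "D \<sigma> i = 0" for i
  proof (rule ccontr)
    assume "D \<sigma> i \<noteq> 0"
    have "D \<sigma> i = ((B *v W) $ \<sigma> i - (A *v Z) $ i) - (\<Sum>j\<in>UNIV. B $ \<sigma> i $ \<sigma> j * (W $ \<sigma> j - Z $ j))"
      using reindex[of "\<lambda>j. B $ \<sigma> i $ j * W $ j"]
      by (simp add: D_def matrix_vector_mult_def algebra_simps sum_subtractf)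
    moreover have "\<bar>\<Sum>j\<in>UNIV. B $ \<sigma> i $ \<sigma> j * (W $ \<sigma> j - Z $ j)\<bar> \<le> (C - 1) * (d / C)"
    proof -
      have "\<bar>\<Sum>j\<in>UNIV. B $ \<sigma> i $ \<sigma> j * (W $ \<sigma> j - Z $ j)\<bar>
          \<le> (\<Sum>j\<in>UNIV. \<bar>B $ \<sigma> i $ \<sigma> j\<bar> * \<bar>W $ \<sigma> j - Z $ j\<bar>)"
        by (rule order_trans[OF sum_abs]) (simp add: abs_mult)
      also have "\<dots> \<le> (\<Sum>j\<in>UNIV. \<bar>B $ \<sigma> i $ \<sigma> j\<bar> * (d / C))"
        by (intro sum_mono mult_left_mono) (auto intro: less_imp_le[OF W])
      also have "\<dots> = (\<Sum>j\<in>UNIV. \<bar>B $ \<sigma> i $ j\<bar>) * (d / C)"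
        using reindex[of "\<lambda>j. \<bar>B $ \<sigma> i $ j\<bar>"]
        by (simp only: sum_distrib_right[symmetric])
      also have "\<dots> \<le> (C - 1) * (d / C)"
        using row \<open>0 < d / C\<close> by (intro mult_right_mono) auto
      finally show ?thesis .
    qed
    ultimately have "\<bar>D \<sigma> i\<bar> < d / C + (C - 1) * (d / C)" using BW[of i] by linarith
    also have "\<dots> = d" using \<open>1 \<le> C\<close> by (simp add: field_simps)
    finally show False using dS[OF \<open>D \<sigma> i \<noteq> 0\<close>] by simp
  qed
  then show ?thesis using that \<sigma> by (simp add: D_def)
qed

text \<open>Distinct exponents keep the \<open>c j\<close> as separate coefficients of one
  polynomial, which is zero because it has infinitely many roots.\<close>

lemma sum_powers_infinite_roots:
  fixes c :: "'n :: finite \<Rightarrow> 'a :: idom"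
  assumes e: "inj e" and inf: "infinite {t. (\<Sum>j\<in>UNIV. c j * t ^ e j) = 0}"
  shows "c i = 0"
proof -
  define p where "p = (\<Sum>j\<in>UNIV. monom (c j) (e j))"
  have "poly p t = (\<Sum>j\<in>UNIV. c j * t ^ e j)" for t
    by (simp add: p_def poly_sum poly_monom)
  then have "p = 0" using inf poly_roots_finite[of p] by auto
  moreover have "coeff p (e i) = (\<Sum>j\<in>UNIV. if j = i then c j else 0)"
    unfolding p_def coeff_sum by (intro sum.cong) (auto dest: injD[OF e])
  ultimately show ?thesis by simp
qed

lemma profile_permutation_similar:
  fixes A B :: "real ^ 'n ^ 'n"
  assumes H: "d_H 2 (profile 1 A) (profile 1 B) = 0"
  obtains \<sigma> where "bij \<sigma>" "\<And>i j. B $ \<sigma> i $ \<sigma> j = A $ i $ j"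
proof -
  obtain e :: "'n \<Rightarrow> nat" where e: "inj e"
    using finite_imp_inj_to_nat_seg[of "UNIV :: 'n set"] by auto
  have "\<exists>\<sigma>. bij \<sigma> \<and> (\<forall>i. (\<Sum>j\<in>UNIV. (B $ \<sigma> i $ \<sigma> j - A $ i $ j) * t ^ e j) = 0)"
    if t: "t \<in> {0<..<1}" for t :: real
  proof -
    \<comment> \<open>For \<open>0 < t < 1\<close> powers of \<open>t\<close> decrease strictly in
      the exponent, so this is an admissible test vector with distinct coordinates.\<close>
    define Z :: "real ^ 'n" where "Z = (\<chi> i. t ^ e i)"
    have "Z $ i \<in> {-1..1}" for i
    proof -
      have "0 \<le> t ^ e i" "t ^ e i \<le> 1" using t by (auto intro: power_le_one)
      then show ?thesis by (simp add: Z_def)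
    qed
    moreover have "inj (($) Z)"
    proof (rule injI)
      fix i j assume "Z $ i = Z $ j"
      then have "e i = e j"
        using t power_strict_decreasing[of "e i" "e j" t] power_strict_decreasing[of "e j" "e i" t]
        by (cases "e i" "e j" rule: linorder_cases) (auto simp: Z_def)
      then show "i = j" using e by (rule injD[rotated])
    qed
    ultimately obtain \<sigma> where "bij \<sigma>"
      "\<And>i. (\<Sum>j\<in>UNIV. (B $ \<sigma> i $ \<sigma> j - A $ i $ j) * Z $ j) = 0"
      using profile_exact_permutation[OF H] by blast
    then show ?thesis by (auto simp: Z_def)
  qed
  then obtain s :: "real \<Rightarrow> 'n \<Rightarrow> 'n" where s: "\<And>t. t \<in> {0<..<1} \<Longrightarrow> bij (s t)"
    "\<And>t i. t \<in> {0<..<1} \<Longrightarrow> (\<Sum>j\<in>UNIV. (B $ s t i $ s t j - A $ i $ j) * t ^ e j) = 0"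
    by metis
  have "infinite {0<..<1::real}" by (simp add: infinite_Ioo)
  \<comment> \<open>There are only finitely many maps from the index type to itself, so some value
    of \<open>s\<close> is taken infinitely often.\<close>
  then obtain t0 where t0: "t0 \<in> {0<..<1}" and inf: "infinite {t \<in> {0<..<1}. s t = s t0}"
    using pigeonhole_infinite[of "{0<..<1}" s] by auto
  have "B $ s t0 i $ s t0 j - A $ i $ j = 0" for i j
  proof (rule sum_powers_infinite_roots[OF e])
    show "infinite {t. (\<Sum>j\<in>UNIV. (B $ s t0 i $ s t0 j - A $ i $ j) * t ^ e j) = 0}"
      using inf by (rule infinite_super[rotated]) (use s(2) in force)
  qed
  then show ?thesis using that[of "s t0"] s(1)[OF t0] by simp
qed

section \<open>Permutation similarity preserves all profiles\<close>

text \<open>Relabelling the sample space by \<open>\<sigma>\<close> preserves the uniform measure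
  and carries all \<open>k\<close> test vectors along simultaneously.\<close>

lemma profile_subset_of_permutation:
  fixes A B :: "real ^ 'n ^ 'n"
  assumes \<sigma>: "bij \<sigma>" and AB: "\<And>i j. B $ \<sigma> i $ \<sigma> j = A $ i $ j"
  shows "profile k A \<subseteq> profile k B"
proof
  fix \<eta> assume "\<eta> \<in> profile k A"
  then obtain Z where \<eta>: "\<eta> = distr (uniform_count_measure UNIV) (borel_Rp (2 * k)) (profile_vector k A Z)"
    and Z: "\<And>j \<omega>. j < k \<Longrightarrow> Z j $ \<omega> \<in> {-1..1}" by (auto simp: profile_def)
  define W where "W = (\<lambda>j. \<chi> \<omega>. Z j $ inv \<sigma> \<omega>)"
  have W: "W j $ \<sigma> i = Z j $ i" for i j using \<sigma> by (simp add: W_def bij_is_inj)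
  have "(B *v W j) $ \<sigma> i = (A *v Z j) $ i" for i j
    using sum.reindex_bij_betw[OF \<sigma>, of "\<lambda>l. B $ \<sigma> i $ l * W j $ l"]
    by (simp add: matrix_vector_mult_def W AB)
  then have PV: "profile_vector k A Z i = profile_vector k B W (\<sigma> i)" for i
    by (auto simp: profile_vector_def W)
  have "\<eta> = distr (uniform_count_measure UNIV) (borel_Rp (2 * k)) (profile_vector k B W)"
  proof (rule measure_eqI)
    fix U assume "U \<in> sets \<eta>"
    then have U: "U \<in> sets (borel_Rp (2 * k))" by (simp add: \<eta>)
    have "{i. profile_vector k B W i \<in> U} = \<sigma> ` {i. profile_vector k A Z i \<in> U}"
      using bij_is_surj[OF \<sigma>] by (auto simp: PV image_iff)
    then have "card {i. profile_vector k B W i \<in> U} = card {i. profile_vector k A Z i \<in> U}"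
      using bij_is_inj[OF \<sigma>] by (simp add: card_image inj_on_subset)
    then show "emeasure \<eta> U =
        emeasure (distr (uniform_count_measure UNIV) (borel_Rp (2 * k)) (profile_vector k B W)) U"
      using U unfolding \<eta>
      by (simp add: emeasure_distr[OF measurable_profile_vector] emeasure_uniform_count_measure
          space_uniform_count_measure vimage_def)
  qed (simp add: \<eta>)
  moreover have "W j $ \<omega> \<in> {-1..1}" if "j < k" for j \<omega> using Z[OF that] by (simp add: W_def)
  ultimately show "\<eta> \<in> profile k B" unfolding profile_def by blast
qed

theorem corollary32:
  fixes K :: real and \<S> :: "(real ^ 'n ^ 'n) set" and A B :: "real ^ 'n ^ 'n"
  assumes "CARD('n) \<ge> 2" and "K \<ge> 1"
    and "\<S> = {M. inf_one_norm M \<le> K}"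
    and "A \<in> \<S>" and "B \<in> \<S>"
  shows "d_action A B = 0 \<longleftrightarrow> d_profile A B = 0"
proof
  assume "d_action A B = 0"
  \<comment> \<open>A convergent series of nonnegative terms with sum zero has only zero terms; the
    one with index 0 compares the 1-profiles.\<close>
  then have "\<forall>k. (1 / 2) ^ Suc k * d_H (2 * Suc k) (profile (Suc k) A) (profile (Suc k) B) = 0"
    unfolding d_action_def
    by (subst (asm) suminf_eq_zero_iff[OF d_action_summable])
      (simp_all add: d_H_profile_bounds del: mult_Suc_right)
  from this[rule_format, of 0] show "d_profile A B = 0"
    by (simp add: d_profile_def numeral_2_eq_2)
next
  assume "d_profile A B = 0"
  then obtain \<sigma> where \<sigma>: "bij \<sigma>" and AB: "\<And>i j. B $ \<sigma> i $ \<sigma> j = A $ i $ j"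
    using profile_permutation_similar[of A B] by (auto simp: d_profile_def)
  \<comment> \<open>The similarity read backwards supplies the reverse inclusion of
    profiles.\<close>
  have "A $ inv \<sigma> i $ inv \<sigma> j = B $ i $ j" for i j
    using AB[of "inv \<sigma> i" "inv \<sigma> j"] \<sigma> by (simp add: bij_is_surj surj_f_inv_f)
  then have "profile k A = profile k B" for k
    using profile_subset_of_permutation[of \<sigma> B A k, OF \<sigma> AB]
      profile_subset_of_permutation[of "inv \<sigma>" A B k, OF bij_imp_bij_inv[OF \<sigma>]] by blast
  then show "d_action A B = 0"
    unfolding d_action_def by (simp only: d_H_profile_self) simp
qed

end
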